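(* Let $a,b>0$ with $a+b=1$, $\gamma=b-a$, $\mu>0$, and let $\{\Phi_t=e^{-t\mathcal L}\}_{t\ge0}$ be the quantum Markov semigroup on the Clifford algebra $\mathfrak C$ (generated by $Q,P$) with generator $$\mathcal L(x)=\tfrac12\mathbf yx+\tfrac12x\mathbf y-\tfrac12\mu^{-1}v^*xv-\tfrac12\mu\,vxv^*-\tfrac12\gamma(vxv+v^*xv^* ),\qquad \mathbf y=\tfrac12\mu^{-1}v^*v+\tfrac12\mu\,vv^*,$$ and let $\rho=\dfrac{2\mathbf y^{-1}}{\mu+\mu^{-1}}$. Suppose $|\gamma|\le\frac{\sqrt2}2$ and put $$\beta=\frac{(\mu+\mu^{-1})-\sqrt{\mu^2+\mu^{-2}}}2.$$ Then for every strictly positive density operator $D\in\mathfrak C$ and all $t\ge0$ $$H(\Phi_t^*(D)\|\rho)\le e^{-2\beta t}H(D\|\rho).$$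
   Context: $\mathfrak C$ is the (4-dimensional) Clifford algebra over $\mathbb C$ generated by self-adjoint unitaries $Q,P$ with $Q^2=P^2=1$, $PQ+QP=0$ (so $\mathfrak C\cong M_2(\mathbb C)$), with normalized trace $\tau$ ($\tau(1)=1$). $z=\frac1{\sqrt2}(Q+iP)$, $w=iQP$, $v=wz$. A density operator is $D\ge0$ with $\tau(D)=1$; $\rho$ is a density operator. $\Phi_t^*$ is the adjoint of $\Phi_t$ for $\langle x,y\rangle=\tau(y^*x)$. $H(D\|\rho)=\tau(D\log D-D\log\rho)$. *)

theory Defs
  imports "HOL-Analysis.Analysis"
begin

text \<open>
  The Clifford algebra on two generators is realised as the full algebra of complex \<open>2 \<times> 2\<close>
  matrices, with \<open>Q\<close> and \<open>P\<close> an arbitrary pair satisfying the defining relations (see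
  \<open>clifford_generators_span\<close>: such a pair always generates the whole matrix algebra).
  Pitfall: the product of the algebra is \<open>**\<close>; the overloaded \<open>*\<close> is componentwise on vectors.
\<close>

type_synonym clifford = "complex^2^2"

definition cscale :: "complex \<Rightarrow> clifford \<Rightarrow> clifford" where
  "cscale c A = map_matrix (\<lambda>x. c * x) A"

definition adj :: "clifford \<Rightarrow> clifford" where
  "adj A = map_matrix cnj (transpose A)"

definition ntrace :: "clifford \<Rightarrow> complex" where
  "ntrace A = trace A / 2"

definition clifford_generators :: "clifford \<Rightarrow> clifford \<Rightarrow> bool" where
  "clifford_generators Q P \<longleftrightarrow>
     adj Q = Q \<and> adj P = P \<and> Q ** Q = mat 1 \<and> P ** P = mat 1 \<and> P ** Q + Q ** P = 0"

lemma clifford_generators_exist: "\<exists>Q P. clifford_generators Q P"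
proof -
  define Q :: clifford where "Q = vector [vector [1, 0], vector [0, -1]]"
  define P :: clifford where "P = vector [vector [0, 1], vector [1, 0]]"
  have "clifford_generators Q P"
    unfolding clifford_generators_def Q_def P_def
    by (simp add: vec_eq_iff forall_2 adj_def transpose_def matrix_matrix_mult_def sum_2 mat_def)
  then show ?thesis by blast
qed

lemma clifford_generators_traceless:
  assumes "A ** A = mat 1" "B ** B = mat 1" "B ** A + A ** B = (0::clifford)"
  shows "A$2$2 = - A$1$1"
proof -
  have "trace (A ** B ** B) = trace (B ** A ** B)"
    by (metis matrix_mul_assoc trace_mul_sym)
  moreover have "B ** A ** B = - (A ** B ** B)"
  proof -
    have "(- C) ** B = - (C ** B)" for C :: clifford
      by (simp add: vec_eq_iff matrix_matrix_mult_def sum_negf)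
    moreover have "B ** A = - (A ** B)" using assms(3) by (simp add: eq_neg_iff_add_eq_0)
    ultimately show ?thesis by simp
  qed
  ultimately have "trace (A ** B ** B) = - trace (A ** B ** B)"
    by (simp add: trace_def sum_negf)
  moreover have "A ** B ** B = A"
    using assms(2) by (metis matrix_mul_assoc matrix_mul_rid)
  ultimately have "trace A = - trace A" by simp
  then have "trace A = 0" by simp
  then show ?thesis by (simp add: trace_def sum_2 eq_neg_iff_add_eq_0 add.commute)
qed

lemma clifford_generators_span:
  assumes "clifford_generators Q P"
  shows "\<exists>c0 c1 c2 c3.
    X = cscale c0 (mat 1) + cscale c1 Q + cscale c2 P + cscale c3 (Q ** P)"
proof -
  have QQ: "Q ** Q = mat 1" and PP: "P ** P = mat 1" and QP: "P ** Q + Q ** P = 0"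
    using assms by (auto simp: clifford_generators_def)
  have tQ: "Q$2$2 = - Q$1$1"
    by (rule clifford_generators_traceless[OF QQ PP QP])
  have tP: "P$2$2 = - P$1$1"
    by (rule clifford_generators_traceless[OF PP QQ]) (use QP in \<open>simp add: add.commute\<close>)
  define a b c where abc: "a = Q$1$1" "b = Q$1$2" "c = Q$2$1"
  define e f g where efg: "e = P$1$1" "f = P$1$2" "g = P$2$1"
  have r1: "a*a + b*c = 1"
    using QQ by (simp add: vec_eq_iff forall_2 matrix_matrix_mult_def sum_2 mat_def tQ abc)
  have r2: "e*e + f*g = 1"
    using PP by (simp add: vec_eq_iff forall_2 matrix_matrix_mult_def sum_2 mat_def tP efg)
  have r3: "2*a*e + b*g + c*f = 0"
    using QP by (simp add: vec_eq_iff forall_2 matrix_matrix_mult_def sum_2 tP tQ abc efg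
        algebra_simps)
  define x y z w where xyzw: "x = X$1$1" "y = X$1$2" "z = X$2$1" "w = X$2$2"
  let ?c0 = "(x + w) / 2"
  let ?c1 = "(a*x + b*z + c*y - a*w) / 2"
  let ?c2 = "(e*x + f*z + g*y - e*w) / 2"
  let ?c3 = "((e*a+f*c)*x + (e*b-f*a)*z + (g*a-e*c)*y + (g*b+e*a)*w) / 2"
  have "X = cscale ?c0 (mat 1) + cscale ?c1 Q + cscale ?c2 P + cscale ?c3 (Q ** P)"
    using r1 r2 r3
    apply (simp add: vec_eq_iff forall_2 matrix_matrix_mult_def sum_2 mat_def cscale_def tP tQ
        abc[symmetric] efg[symmetric] xyzw[symmetric])
    apply (simp add: field_simps)
    apply (intro conjI; algebra)
    done
  then show ?thesis by blast
qed

definition cliff_z :: "clifford \<Rightarrow> clifford \<Rightarrow> clifford" where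
  "cliff_z Q P = (1 / sqrt 2) *\<^sub>R (Q + cscale \<i> P)"

definition cliff_w :: "clifford \<Rightarrow> clifford \<Rightarrow> clifford" where
  "cliff_w Q P = cscale \<i> (Q ** P)"

definition cliff_v :: "clifford \<Rightarrow> clifford \<Rightarrow> clifford" where
  "cliff_v Q P = cliff_w Q P ** cliff_z Q P"

definition cliff_y :: "clifford \<Rightarrow> clifford \<Rightarrow> real \<Rightarrow> clifford" where
  "cliff_y Q P \<mu> =
     (let v = cliff_v Q P in
      (1/2 * inverse \<mu>) *\<^sub>R (adj v ** v) + (1/2 * \<mu>) *\<^sub>R (v ** adj v))"

definition generator :: "clifford \<Rightarrow> clifford \<Rightarrow> real \<Rightarrow> real \<Rightarrow> clifford \<Rightarrow> clifford" where
  "generator Q P \<gamma> \<mu> x =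
     (let v = cliff_v Q P; y = cliff_y Q P \<mu> in
      (1/2) *\<^sub>R (y ** x) + (1/2) *\<^sub>R (x ** y)
      - (1/2 * inverse \<mu>) *\<^sub>R (adj v ** x ** v)
      - (1/2 * \<mu>) *\<^sub>R (v ** x ** adj v)
      - (1/2 * \<gamma>) *\<^sub>R (v ** x ** v + adj v ** x ** adj v))"

text \<open>The operator exponential \<open>exp(- t L)\<close>, given by its power series evaluated at \<open>x\<close>.\<close>

definition exp_semigroup :: "(clifford \<Rightarrow> clifford) \<Rightarrow> real \<Rightarrow> clifford \<Rightarrow> clifford" where
  "exp_semigroup L t x = (\<Sum>n. ((- t) ^ n / fact n) *\<^sub>R (L ^^ n) x)"

definition tr_inner :: "clifford \<Rightarrow> clifford \<Rightarrow> complex" where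
  "tr_inner x y = ntrace (adj y ** x)"

definition tr_adjoint :: "(clifford \<Rightarrow> clifford) \<Rightarrow> clifford \<Rightarrow> clifford" where
  "tr_adjoint T = (THE S. \<forall>x y. tr_inner (T x) y = tr_inner x (S y))"

definition nonneg_op :: "clifford \<Rightarrow> bool" where
  "nonneg_op A \<longleftrightarrow> adj A = A \<and> (\<forall>x::complex^2. 0 \<le> Re (\<Sum>i\<in>UNIV. cnj (x$i) * (A *v x)$i))"

definition strictly_pos_op :: "clifford \<Rightarrow> bool" where
  "strictly_pos_op A \<longleftrightarrow>
     adj A = A \<and> (\<forall>x::complex^2. x \<noteq> 0 \<longrightarrow> 0 < Re (\<Sum>i\<in>UNIV. cnj (x$i) * (A *v x)$i))"

definition density_operator :: "clifford \<Rightarrow> bool" where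
  "density_operator D \<longleftrightarrow> nonneg_op D \<and> ntrace D = 1"

text \<open>
  Functional calculus for self-adjoint elements: if \<open>A = U diag(d) U\<^sup>*\<close> with \<open>U\<close> unitary and
  \<open>d\<close> real, then \<open>f(A) = U diag(f d) U\<^sup>*\<close>, independently of the diagonalisation.
\<close>

definition real_diag :: "real^2 \<Rightarrow> clifford" where
  "real_diag d = (\<chi> i j. if i = j then complex_of_real (d$i) else 0)"

definition fun_calc :: "(real \<Rightarrow> real) \<Rightarrow> clifford \<Rightarrow> clifford" where
  "fun_calc f A =
     (THE B. \<exists>U d. adj U ** U = mat 1 \<and> A = U ** real_diag d ** adj U \<and>
                   B = U ** real_diag (\<chi> i. f (d$i)) ** adj U)"

text \<open>
  Since \<open>ln 0 = 0\<close>, the product \<open>D ** op_log D\<close> follows the convention \<open>0 log 0 = 0\<close>.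
  The trace below is real for self-adjoint \<open>D\<close> and \<open>\<rho>\<close>.
\<close>

definition op_log :: "clifford \<Rightarrow> clifford" where
  "op_log = fun_calc ln"

definition rel_entropy :: "clifford \<Rightarrow> clifford \<Rightarrow> real" where
  "rel_entropy D \<rho> = Re (ntrace (D ** op_log D - D ** op_log \<rho>))"

definition cliff_rho :: "clifford \<Rightarrow> clifford \<Rightarrow> real \<Rightarrow> clifford" where
  "cliff_rho Q P \<mu> = (2 / (\<mu> + inverse \<mu>)) *\<^sub>R matrix_inv (cliff_y Q P \<mu>)"

end

theory Submission
  imports Defs
begin

text \<open>
  The elements \<open>Q\<close>, \<open>P\<close>, \<open>w\<close> are self-adjoint, square to one and anticommute, so they play the role
  of the Pauli matrices: a density operator is \<open>D = 1 + x Q + y P + z w\<close> with a real vector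
  \<open>(x, y, z)\<close> in the unit ball, and its eigenvalues are \<open>1 + r\<close> and \<open>1 - r\<close> with \<open>r\<close> the length of
  that vector. Put \<open>s = \<mu> + \<mu>\<^sup>-\<^sup>1\<close> and \<open>m = (\<mu> - \<mu>\<^sup>-\<^sup>1) / s\<close>; then \<open>\<rho> = 1 + m w\<close>, and the adjoint semigroup
  moves the vector along
  \<open>x' = - (s/2 - \<gamma>) x\<close>, \<open>y' = - (s/2 + \<gamma>) y\<close>, \<open>z' = - s (z - m)\<close>.
  With \<open>\<eta>(r) = ((1 + r) ln (1 + r) + (1 - r) ln (1 - r)) / 2\<close>, whose derivative is \<open>artanh\<close>, the
  relative entropy is \<open>H = \<eta>(r) - \<eta>(m) - artanh m (z - m)\<close>. The theorem thus becomes a statement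
  about a flow in the unit ball, and by Gronwall it suffices to show \<open>- dH/dt \<ge> (s - \<sigma>) H\<close> with
  \<open>\<sigma> = sqrt (s\<^sup>2 - 2)\<close>, because \<open>2 \<beta> = s - \<sigma>\<close>.

  Lowering the rates of \<open>x\<close> and \<open>y\<close> to \<open>(s - sqrt 2) / 2\<close> only decreases the dissipation, and what
  remains depends on \<open>r\<close> and \<open>z\<close> alone. For \<open>m \<ge> 0\<close> write \<open>R = artanh r\<close>, \<open>M = artanh m\<close> and
  \<open>j = 1 - z / r\<close>; the difference of the two sides is then a quadratic polynomial \<open>G - B j + K j\<^sup>2\<close>.
  Convexity of \<open>\<eta>\<close> gives \<open>G \<ge> 0\<close>, so only \<open>B > 0\<close> is of interest, and since \<open>sqrt 2 \<le> \<sigma>\<close>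
  (because \<open>s \<ge> 2\<close>) this forces \<open>r > m\<close>. There the trapezoid rule for \<open>artanh\<close>, convex on \<open>[0, 1)\<close>,
  improves the bound to \<open>G \<ge> (s + \<sigma>) / 2 (R - M) (r - m)\<close>. In terms of \<open>a = R (r - m)\<close> and
  \<open>b = r (R - M)\<close> one has \<open>B \<le> s a + sqrt 2 b\<close> and \<open>(1 - m) b \<le> a \<le> b\<close>, which is what the
  discriminant inequality \<open>B\<^sup>2 \<le> (s + sqrt 2) (s + \<sigma>) a b \<le> 4 K G\<close> needs
  (\<open>discriminant_bound\<close>, \<open>radial_dissipation\<close>). The case \<open>m < 0\<close> follows by reflecting \<open>z\<close>.
\<close>

section \<open>Convexity of the binary information function\<close>

text \<open>
  The normalised trace of \<open>D log D\<close> for a density operator with eigenvalues \<open>1 + r\<close> and \<open>1 - r\<close>.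
\<close>
definition binary_info :: "real \<Rightarrow> real" where
  "binary_info r = ((1 + r) * ln (1 + r) + (1 - r) * ln (1 - r)) / 2"

lemma binary_info_minus [simp]: "binary_info (- r) = binary_info r"
  by (simp add: binary_info_def)

lemma artanh_eq_ln_diff:
  fixes r :: real assumes "\<bar>r\<bar> < 1" shows "artanh r = (ln (1 + r) - ln (1 - r)) / 2"
proof -
  have "1 + r > 0" "1 - r > 0" using assms by auto
  then show ?thesis by (simp add: artanh_def ln_div)
qed

lemma binary_info_eq_artanh:
  assumes "\<bar>r\<bar> < 1"
  shows "binary_info r = r * artanh r + (ln (1 + r) + ln (1 - r)) / 2"
  using assms by (simp add: artanh_eq_ln_diff binary_info_def add_divide_distrib diff_divide_distrib algebra_simps)

lemma binary_info_has_derivative: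
  assumes "\<bar>r\<bar> < 1"
  shows "(binary_info has_real_derivative artanh r) (at r)"
proof -
  have "((\<lambda>r. ((1 + r) * ln (1 + r) + (1 - r) * ln (1 - r)) / 2) has_real_derivative
      (ln (1 + r) - ln (1 - r)) / 2) (at r)"
    using assms by (auto intro!: derivative_eq_intros)
  then show ?thesis
    using assms by (simp add: artanh_eq_ln_diff binary_info_def[abs_def])
qed

lemma one_minus_square_pos: "\<bar>r\<bar> < 1 \<Longrightarrow> 0 < 1 - (r::real)^2"
  by (simp add: abs_square_less_1)

lemma binary_info_tangent:
  assumes "\<bar>r\<bar> < 1" "\<bar>m\<bar> < 1"
  shows "artanh m * (r - m) \<le> binary_info r - binary_info m"
  by (rule f''_imp_f'[where C = "{-1<..<1}" and f'' = "\<lambda>x. 1 / (1 - x\<^sup>2)"])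
     (use assms in \<open>auto intro!: binary_info_has_derivative artanh_real_has_field_derivative
        simp: abs_square_le_1\<close>)

lemma artanh_tangent:
  fixes m r :: real
  assumes "0 \<le> m" "m < 1" "0 \<le> r" "r < 1"
  shows "(r - m) / (1 - m\<^sup>2) \<le> artanh r - artanh m"
proof -
  have "1 / (1 - m\<^sup>2) * (r - m) \<le> artanh r - artanh m"
  proof (rule f''_imp_f'[where C = "{0..<1}" and f'' = "\<lambda>x. 2 * x / (1 - x\<^sup>2)^2"])
    fix x :: real assume x: "x \<in> {0..<1}"
    then have p: "1 - x\<^sup>2 \<noteq> 0" using one_minus_square_pos[of x] by auto
    show "(artanh has_real_derivative 1 / (1 - x\<^sup>2)) (at x)"
      using x by (intro artanh_real_has_field_derivative) auto
    show "((\<lambda>x. 1 / (1 - x\<^sup>2)) has_real_derivative 2 * x / (1 - x\<^sup>2)^2) (at x)"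
      using p by (auto intro!: derivative_eq_intros simp: power2_eq_square)
  qed (use assms in auto)
  then show ?thesis by simp
qed

lemma artanh_bounds:
  fixes m :: real
  assumes "0 \<le> m" "m < 1"
  shows "m \<le> artanh m" "artanh m \<le> m / (1 - m\<^sup>2)"
  using artanh_tangent[of 0 m] artanh_tangent[of m 0] assms by auto

lemma artanh_mono:
  fixes m r :: real
  assumes "0 \<le> m" "m \<le> r" "r < 1"
  shows "artanh m \<le> artanh r"
proof -
  have "0 \<le> (r - m) / (1 - m\<^sup>2)"
    using assms one_minus_square_pos[of m] by simp
  then show ?thesis using artanh_tangent[of m r] assms by linarith
qed

text \<open>
  The ratio \<open>artanh r / r\<close> increases: \<open>artanh\<close> is convex on \<open>[0, 1)\<close> and vanishes at \<open>0\<close>. The tangent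
  at \<open>m\<close> bounds both \<open>artanh r\<close> from below and \<open>artanh m\<close> from above.
\<close>
lemma artanh_star_shaped:
  fixes m r :: real
  assumes "0 \<le> m" "m \<le> r" "r < 1"
  shows "r * artanh m \<le> m * artanh r"
proof -
  have "m * ((r - m) / (1 - m\<^sup>2)) \<le> m * (artanh r - artanh m)"
    using artanh_tangent[of m r] assms by (intro mult_left_mono) auto
  moreover have "(r - m) * artanh m \<le> (r - m) * (m / (1 - m\<^sup>2))"
    using artanh_bounds[of m] assms by (intro mult_left_mono) auto
  ultimately have "(r - m) * artanh m \<le> m * (artanh r - artanh m)"
    by (simp add: mult.commute)
  then show ?thesis by (simp add: algebra_simps)
qed

text \<open>
  The left side is the integral of the convex function \<open>artanh\<close> over \<open>[m, r]\<close>, and the trapezoid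
  rule overestimates such an integral.
\<close>
lemma binary_info_trapezoid:
  assumes "0 \<le> m" "m \<le> r" "r < 1"
  shows "binary_info r - binary_info m \<le> (artanh r + artanh m) / 2 * (r - m)"
proof -
  let ?f = "\<lambda>r. (artanh r + artanh m) / 2 * (r - m) - binary_info r"
  have "?f m \<le> ?f r"
  proof (rule DERIV_nonneg_imp_nondecreasing[OF assms(2)])
    fix x assume x: "m \<le> x" "x \<le> r"
    define D where "D = 1 / (1 - x\<^sup>2)"
    have [derivative_intros]: "(artanh has_real_derivative D) (at x)"
      unfolding D_def using x assms by (intro artanh_real_has_field_derivative) auto
    have "(?f has_real_derivative ((x - m) * D - (artanh x - artanh m)) / 2) (at x)"
      using assms x by (auto intro!: derivative_eq_intros binary_info_has_derivative simp: field_simps)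
    moreover have "(m - x) * D \<le> artanh m - artanh x"
      using artanh_tangent[of x m] assms x by (auto simp: D_def)
    then have "0 \<le> ((x - m) * D - (artanh x - artanh m)) / 2"
      by (simp add: algebra_simps)
    ultimately show "\<exists>y. (?f has_real_derivative y) (at x) \<and> 0 \<le> y" by blast
  qed
  then show ?thesis by simp
qed

text \<open>
  The factor \<open>1 - r\<close> more than compensates the growth of \<open>artanh r / r\<close>: in the derivative of the
  difference the singular term is \<open>m (1 - r) / (1 - r\<^sup>2) = m / (1 + r) \<le> m\<close>, and \<open>m \<le> artanh m\<close>.
\<close>
lemma artanh_damped_ratio_decreasing:
  fixes m r :: real
  assumes "0 \<le> m" "m \<le> r" "r < 1"
  shows "m * artanh r * (1 - r) \<le> r * artanh m * (1 - m)"
proof -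
  let ?f = "\<lambda>r. r * artanh m * (1 - m) - m * artanh r * (1 - r)"
  have "?f m \<le> ?f r"
  proof (rule DERIV_nonneg_imp_nondecreasing[OF assms(2)])
    fix x assume x: "m \<le> x" "x \<le> r"
    define D where "D = 1 / (1 - x\<^sup>2)"
    have [derivative_intros]: "(artanh has_real_derivative D) (at x)"
      unfolding D_def using x assms by (intro artanh_real_has_field_derivative) auto
    have "1 - x\<^sup>2 = (1 - x) * (1 + x)" by (simp add: power2_eq_square algebra_simps)
    then have "D * (1 - x) \<le> 1" using x assms by (simp add: D_def)
    then have "m * (D * (1 - x)) \<le> m * 1"
      using assms by (intro mult_left_mono) auto
    moreover have "m * artanh m \<le> m * artanh x"
      using artanh_mono[of m x] assms x by (intro mult_left_mono) auto
    moreover have "m \<le> artanh m"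
      using artanh_bounds[of m] assms by auto
    ultimately have "0 \<le> artanh m * (1 - m) + m * artanh x - m * (D * (1 - x))"
      by (simp add: algebra_simps)
    moreover have "(?f has_real_derivative artanh m * (1 - m) + m * artanh x - m * (D * (1 - x))) (at x)"
      by (auto intro!: derivative_eq_intros simp: algebra_simps)
    ultimately show "\<exists>y. (?f has_real_derivative y) (at x) \<and> 0 \<le> y" by blast
  qed
  then show ?thesis by simp
qed

section \<open>The entropy dissipation inequality\<close>

text \<open>
  The difference \<open>(artanh z - artanh m) (z - m)\<close> is the sum of the two Bregman divergences of
  \<open>binary_info\<close> between \<open>z\<close> and \<open>m\<close>, so it dominates either of them.
\<close>
lemma binary_info_convex_decay:
  assumes "\<bar>z\<bar> < 1" "\<bar>m\<bar> < 1" "\<kappa> \<le> s" "0 \<le> s"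
  shows "\<kappa> * (binary_info z - binary_info m - artanh m * (z - m))
         \<le> s * ((artanh z - artanh m) * (z - m))"
proof -
  let ?d = "binary_info z - binary_info m - artanh m * (z - m)"
  have "?d \<ge> 0" "?d \<le> (artanh z - artanh m) * (z - m)"
    using binary_info_tangent[of z m] binary_info_tangent[of m z] assms
    by (auto simp: algebra_simps)
  then show ?thesis
    using assms by (meson mult_left_mono mult_right_mono order_trans)
qed

lemma quadratic_nonneg:
  fixes K B c j :: real
  assumes "0 < K" "B\<^sup>2 \<le> 4 * K * c"
  shows "0 \<le> c - j * B + K * j\<^sup>2"
proof -
  have "0 \<le> (2 * K * j - B)\<^sup>2 + (4 * K * c - B\<^sup>2)" using assms by simp
  also have "\<dots> = 4 * K * (c - j * B + K * j\<^sup>2)" by (simp add: power2_eq_square algebra_simps)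
  finally show ?thesis using assms by (simp add: zero_le_mult_iff)
qed

text \<open>
  The left side is convex in \<open>a\<close>, so the hypothesis \<open>(b - a) (a - (1 - m) b) \<ge> 0\<close> replaces \<open>a\<^sup>2\<close> by
  \<open>(2 - m) a b - (1 - m) b\<^sup>2\<close>. The coefficient of \<open>b\<^sup>2\<close> is then \<open>2 - s\<^sup>2 (1 - m) = 2 - 4 / (1 + m) \<le> 0\<close>,
  so that \<open>b\<^sup>2\<close> may be lowered to \<open>a b\<close>; what results is exactly \<open>(s + sqrt 2)\<^sup>2 a b\<close>,
  and \<open>sqrt 2 \<le> \<sigma>\<close>.
\<close>
lemma discriminant_bound:
  fixes a b s \<sigma> m :: real
  assumes "(1 - m) * b \<le> a" "a \<le> b" "0 \<le> a" "0 \<le> m" "m < 1" "0 < s"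
    and s: "s\<^sup>2 * (1 - m\<^sup>2) = 4" and \<sigma>: "sqrt 2 \<le> \<sigma>"
  shows "(s * a + sqrt 2 * b)\<^sup>2 \<le> (s + sqrt 2) * (s + \<sigma>) * (a * b)"
proof -
  have "0 \<le> s\<^sup>2 * ((b - a) * (a - (1 - m) * b))"
    using assms by (intro mult_nonneg_nonneg) auto
  moreover have "0 \<le> (s\<^sup>2 * (1 - m) - 2) * (b * (b - a))"
  proof (intro mult_nonneg_nonneg)
    have "s\<^sup>2 * (1 - m) * (1 + m) = 4" using s by (simp add: power2_eq_square algebra_simps)
    moreover have "s\<^sup>2 * (1 - m) * (1 + m) \<le> s\<^sup>2 * (1 - m) * 2"
      using assms by (intro mult_left_mono) auto
    ultimately show "0 \<le> s\<^sup>2 * (1 - m) - 2" by linarith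
  qed (use assms in auto)
  moreover have "0 \<le> (s + sqrt 2) * (\<sigma> - sqrt 2) * (a * b)"
    using assms by (intro mult_nonneg_nonneg) auto
  moreover have "sqrt 2 * (sqrt 2 * x) = 2 * x" for x
    by (simp add: mult.assoc[symmetric])
  ultimately show ?thesis by (simp add: power2_eq_square algebra_simps)
qed

text \<open>
  This is the pointwise inequality behind the theorem. The right side is the entropy dissipation at
  a point of length \<open>r\<close> and height \<open>z\<close> when both transversal rates equal \<open>(s - sqrt 2) / 2\<close>. In the
  variable \<open>j = 1 - z / r\<close> the claim is the nonnegativity of a quadratic polynomial.
\<close>
lemma radial_dissipation:
  fixes m r z s \<sigma> :: real
  assumes m: "0 \<le> m" "m < 1" and r: "0 < r" "r < 1" and z: "\<bar>z\<bar> \<le> r"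
    and s: "0 < s" "s\<^sup>2 * (1 - m\<^sup>2) = 4" and \<sigma>: "sqrt 2 \<le> \<sigma>" "\<sigma> \<le> s"
  shows "(s - \<sigma>) * (binary_info r - binary_info m - artanh m * (z - m))
    \<le> artanh r / r * ((s - sqrt 2) / 2 * (r\<^sup>2 - z\<^sup>2) + s * z * (z - m)) - s * artanh m * (z - m)"
proof -
  define R M j where "R = artanh r" and "M = artanh m" and "j = 1 - z / r"
  define G0 where "G0 = s * ((R - M) * (r - m)) - (s - \<sigma>) * (binary_info r - binary_info m - M * (r - m))"
  define B where "B = s * (R * (r - m)) + \<sigma> * (r * (R - M)) - (\<sigma> - sqrt 2) * (R * r)"
  define K where "K = (s + sqrt 2) / 2 * (R * r)"
  have zj: "z = r * (1 - j)" using r by (simp add: j_def)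
  have j: "0 \<le> j" using z r by (simp add: j_def)
  have RM: "0 < R" "0 \<le> M"
    using artanh_bounds[of r] artanh_bounds[of m] m r by (auto simp: R_def M_def)
  have gap: "artanh r / r * ((s - sqrt 2) / 2 * (r\<^sup>2 - z\<^sup>2) + s * z * (z - m)) - s * artanh m * (z - m)
      - (s - \<sigma>) * (binary_info r - binary_info m - artanh m * (z - m)) = G0 - j * B + K * j\<^sup>2"
  proof -
    have "artanh r / r * ((s - sqrt 2) / 2 * (r\<^sup>2 - z\<^sup>2) + s * z * (z - m))
      = R * ((s - sqrt 2) / 2 * (r * (1 - (1 - j)\<^sup>2)) + s * (1 - j) * (r * (1 - j) - m))"
      using r unfolding zj R_def by (simp add: power2_eq_square field_simps)
    then show ?thesis
      unfolding G0_def B_def K_def R_def[symmetric] M_def[symmetric] unfolding zj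
      by (simp add: power2_eq_square field_simps)
  qed
  \<comment> \<open>As \<open>j \<ge> 0\<close>, a nonpositive \<open>B\<close> leaves three nonnegative terms.\<close>
  have "0 \<le> G0 - j * B + K * j\<^sup>2"
  proof (cases "B \<le> 0")
    case True
    have "0 \<le> G0"
      using binary_info_convex_decay[of r m "s - \<sigma>" s] m r s \<sigma>
      by (simp add: G0_def R_def M_def) (smt (verit) real_sqrt_ge_zero)
    moreover have "j * B \<le> 0" using True j by (simp add: mult_nonneg_nonpos)
    moreover have "0 \<le> K * j\<^sup>2" using RM r s by (simp add: K_def)
    ultimately show ?thesis by linarith
  next
    case False
    define a b where "a = R * (r - m)" and "b = r * (R - M)"
    have mr: "m \<le> r"
    proof (rule ccontr)
      assume "\<not> m \<le> r"
      then have "r < m" by simp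
      then have "R * (r - m) \<le> 0" "R \<le> M"
        using RM artanh_mono[of r m] r m by (auto simp: R_def M_def mult_nonneg_nonpos)
      then have "s * (R * (r - m)) \<le> 0" "0 \<le> sqrt 2 * (r * (M - R))" "0 \<le> (\<sigma> - sqrt 2) * (r * M)"
        using s r \<sigma> RM by (auto simp: mult_nonneg_nonpos)
      then have "B \<le> 0" unfolding B_def by (simp add: algebra_simps)
      with False show False by simp
    qed
    have ab: "(1 - m) * b \<le> a" "a \<le> b" "0 \<le> a" "b \<le> R * r"
      using artanh_damped_ratio_decreasing[of m r] artanh_star_shaped[of m r] m r mr RM
      by (auto simp: a_def b_def R_def M_def algebra_simps)
    \<comment> \<open>As \<open>b \<le> R r\<close>, the negative term of \<open>B\<close> lowers the coefficient \<open>\<sigma>\<close> of \<open>b\<close> to \<open>sqrt 2\<close>.\<close>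
    have "B = s * a + sqrt 2 * b - (\<sigma> - sqrt 2) * (R * r - b)"
      by (simp add: B_def a_def b_def algebra_simps)
    moreover have "0 \<le> (\<sigma> - sqrt 2) * (R * r - b)"
      using ab \<sigma> by (intro mult_nonneg_nonneg) auto
    ultimately have "B \<le> s * a + sqrt 2 * b" by linarith
    then have "B\<^sup>2 \<le> (s * a + sqrt 2 * b)\<^sup>2"
      using False by (intro power_mono) auto
    also have "\<dots> \<le> (s + sqrt 2) * (s + \<sigma>) * (a * b)"
      using discriminant_bound ab m s \<sigma> by blast
    also have "\<dots> = 4 * K * ((s + \<sigma>) / 2 * ((R - M) * (r - m)))"
      by (simp add: K_def a_def b_def)
    also have "\<dots> \<le> 4 * K * G0"
    proof (intro mult_left_mono)
      have "binary_info r - binary_info m - M * (r - m) \<le> (R - M) * (r - m) / 2"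
        using binary_info_trapezoid[of m r] m mr r by (simp add: R_def M_def field_simps)
      then have "(s - \<sigma>) * (binary_info r - binary_info m - M * (r - m)) \<le> (s - \<sigma>) * ((R - M) * (r - m) / 2)"
        using \<sigma> by (intro mult_left_mono) auto
      then show "(s + \<sigma>) / 2 * ((R - M) * (r - m)) \<le> G0"
        unfolding G0_def by (simp add: field_simps)
      show "0 \<le> 4 * K" using RM r s by (simp add: K_def)
    qed
    finally show ?thesis
      using RM r s by (intro quadratic_nonneg) (auto simp: K_def intro!: mult_pos_pos add_pos_pos)
  qed
  with gap show ?thesis by linarith
qed

text \<open>
  Reflecting \<open>z\<close> and \<open>m\<close> changes neither side, since \<open>binary_info\<close> is even and \<open>artanh\<close> is odd.
\<close>
lemma radial_dissipation_signed:
  fixes m r z s \<sigma> :: real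
  assumes m: "\<bar>m\<bar> < 1" and r: "0 < r" "r < 1" and z: "\<bar>z\<bar> \<le> r"
    and s: "0 < s" "s\<^sup>2 * (1 - m\<^sup>2) = 4" and \<sigma>: "sqrt 2 \<le> \<sigma>" "\<sigma> \<le> s"
  shows "(s - \<sigma>) * (binary_info r - binary_info m - artanh m * (z - m))
    \<le> artanh r / r * ((s - sqrt 2) / 2 * (r\<^sup>2 - z\<^sup>2) + s * z * (z - m)) - s * artanh m * (z - m)"
proof (cases "0 \<le> m")
  case True
  then show ?thesis using radial_dissipation assms by auto
next
  case False
  have "artanh (- m) = - artanh m" using artanh_minus_real[of m] m by simp
  then show ?thesis
    using radial_dissipation[of "-m" r "-z" s \<sigma>] assms False by (simp add: algebra_simps)
qed

section \<open>The flow in the unit ball\<close>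

lemma gronwall_decay:
  fixes f :: "real \<Rightarrow> real"
  assumes "\<And>u. 0 \<le> u \<Longrightarrow> (f has_real_derivative f' u) (at u)"
    and "\<And>u. 0 \<le> u \<Longrightarrow> f' u \<le> - k * f u" and "0 \<le> t"
  shows "f t \<le> exp (- k * t) * f 0"
proof -
  have "exp (k * t) * f t \<le> exp (k * 0) * f 0"
  proof (rule DERIV_nonpos_imp_nonincreasing[OF assms(3)])
    fix u assume u: "0 \<le> u" "u \<le> t"
    have "((\<lambda>u. exp (k * u) * f u) has_real_derivative exp (k * u) * (f' u + k * f u)) (at u)"
      using u by (auto intro!: derivative_eq_intros assms(1) simp: algebra_simps)
    moreover have "exp (k * u) * (f' u + k * f u) \<le> 0"
      using assms(2)[OF u(1)] by (simp add: mult_nonneg_nonpos)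
    ultimately show "\<exists>y. ((\<lambda>u. exp (k * u) * f u) has_real_derivative y) (at u) \<and> y \<le> 0" by blast
  qed
  then have "exp (- k * t) * (exp (k * t) * f t) \<le> exp (- k * t) * f 0"
    by (intro mult_left_mono) auto
  moreover have "exp (- k * t) * (exp (k * t) * f t) = f t"
    unfolding mult.assoc[symmetric] mult_exp_exp by simp
  ultimately show ?thesis by (simp only:)
qed

lemma deriv_exp_scale:
  fixes k c t :: real
  shows "((\<lambda>t. exp (k * t) * c) has_real_derivative k * (exp (k * t) * c)) (at t)"
  by (rule DERIV_cong[OF DERIV_cmult_right[OF DERIV_fun_exp[OF DERIV_cmult[OF DERIV_ident]]]]) simp

text \<open>
  The entropy relative to \<open>1 + m w\<close> of the density operator with Bloch vector \<open>(x, y, z)\<close>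
  (see \<open>rel_entropy_pauli\<close>).
\<close>
definition bloch_entropy :: "real \<Rightarrow> real \<Rightarrow> real \<Rightarrow> real \<Rightarrow> real" where
  "bloch_entropy m x y z =
     binary_info (sqrt (x\<^sup>2 + y\<^sup>2 + z\<^sup>2)) - binary_info m - artanh m * (z - m)"

text \<open>
  The trajectory of a Bloch vector under the adjoint semigroup. For \<open>s = \<mu> + \<mu>\<^sup>-\<^sup>1\<close> the relation
  \<open>s\<^sup>2 (1 - m\<^sup>2) = 4\<close> says that \<open>m s = \<mu> - \<mu>\<^sup>-\<^sup>1\<close> up to sign.
\<close>
locale bloch_flow =
  fixes s \<gamma> m x0 y0 z0 :: real
  assumes s: "0 < s" "s\<^sup>2 * (1 - m\<^sup>2) = 4" and m: "\<bar>m\<bar> < 1"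
    and \<gamma>: "\<bar>\<gamma>\<bar> \<le> sqrt 2 / 2"
    and ball: "x0\<^sup>2 + y0\<^sup>2 + z0\<^sup>2 < 1"
begin

definition "x t = exp (- (s / 2 - \<gamma>) * t) * x0"
definition "y t = exp (- (s / 2 + \<gamma>) * t) * y0"
definition "z t = m + exp (- s * t) * (z0 - m)"
definition "sqr t = (x t)\<^sup>2 + (y t)\<^sup>2 + (z t)\<^sup>2"

lemma s_ge_2: "2 \<le> s"
proof -
  have "s\<^sup>2 * (1 - m\<^sup>2) \<le> s\<^sup>2 * 1" by (intro mult_left_mono) auto
  then have "2\<^sup>2 \<le> s\<^sup>2" using s by simp
  then show ?thesis by (rule power2_le_imp_le) (use s in simp)
qed

lemma deriv_x: "(x has_real_derivative - (s / 2 - \<gamma>) * x t) (at t)"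
  unfolding x_def[abs_def] by (rule deriv_exp_scale)

lemma deriv_y: "(y has_real_derivative - (s / 2 + \<gamma>) * y t) (at t)"
  unfolding y_def[abs_def] by (rule deriv_exp_scale)

lemma deriv_z: "(z has_real_derivative - s * (z t - m)) (at t)"
  using DERIV_add[OF DERIV_const[of m] deriv_exp_scale[of "- s" "z0 - m" t]]
  unfolding z_def[abs_def] by simp

definition "sqr' t = - 2 * ((s / 2 - \<gamma>) * (x t)\<^sup>2 + (s / 2 + \<gamma>) * (y t)\<^sup>2 + s * z t * (z t - m))"

lemma deriv_sqr: "(sqr has_real_derivative sqr' t) (at t)"
proof -
  have "(sqr has_real_derivative 2 * x t * (- (s / 2 - \<gamma>) * x t) + 2 * y t * (- (s / 2 + \<gamma>) * y t)
      + 2 * z t * (- s * (z t - m))) (at t)"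
    unfolding sqr_def[abs_def] by (rule derivative_eq_intros deriv_x deriv_y deriv_z refl | simp)+
  then show ?thesis by (simp add: sqr'_def power2_eq_square algebra_simps)
qed

text \<open>
  Both transversal rates are at least \<open>s / 2 - sqrt 2 / 2\<close>, and \<open>sqr t - (z t)\<^sup>2\<close> is the squared
  distance from the axis.
\<close>
lemma sqr'_le: "sqr' t \<le> - (s - sqrt 2) * (sqr t - (z t)\<^sup>2) - 2 * s * z t * (z t - m)"
proof -
  have "0 \<le> (sqrt 2 / 2 - \<gamma>) * (x t)\<^sup>2" "0 \<le> (sqrt 2 / 2 + \<gamma>) * (y t)\<^sup>2"
    using \<gamma> by auto
  then show ?thesis by (simp add: sqr'_def sqr_def algebra_simps)
qed

text \<open>
  The quantity \<open>1 - sqr t\<close> decays at most at the rate \<open>s - sqrt 2\<close>. After cancelling the terms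
  proportional to it, this is the nonnegativity of \<open>(s - sqrt 2) - 2 s m z + (s + sqrt 2) z\<^sup>2\<close>, whose
  discriminant is negative because \<open>s\<^sup>2 m\<^sup>2 = s\<^sup>2 - 4 < (s - sqrt 2) (s + sqrt 2)\<close>.
\<close>
lemma ball_invariant:
  assumes "0 \<le> t" shows "sqr t < 1"
proof -
  have "sqr t - 1 \<le> exp (- (s - sqrt 2) * t) * (sqr 0 - 1)"
  proof (rule gronwall_decay[where f = "\<lambda>t. sqr t - 1" and f' = sqr', OF _ _ assms])
    show "((\<lambda>t. sqr t - 1) has_real_derivative sqr' u) (at u)" for u
      by (auto intro!: derivative_eq_intros deriv_sqr)
    show "sqr' u \<le> - (s - sqrt 2) * (sqr u - 1)" for u
    proof -
      have "s\<^sup>2 * m\<^sup>2 = s\<^sup>2 - 4" using s by (simp add: algebra_simps)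
      moreover have "(s + sqrt 2) * (s - sqrt 2) = s\<^sup>2 - 2"
        by (simp add: square_diff_square_factored[symmetric] power2_eq_square)
      ultimately have "(2 * s * m)\<^sup>2 \<le> 4 * (s + sqrt 2) * (s - sqrt 2)"
        by (simp add: power_mult_distrib mult.assoc del: distrib_left_numeral)
      then have "0 \<le> (s - sqrt 2) - z u * (2 * s * m) + (s + sqrt 2) * (z u)\<^sup>2"
        using s by (intro quadratic_nonneg) (auto intro: add_pos_pos)
      then show ?thesis using sqr'_le[of u] by (simp add: algebra_simps power2_eq_square)
    qed
  qed
  also have "\<dots> < 0" using ball by (simp add: sqr_def x_def y_def z_def mult_pos_neg)
  finally show ?thesis by simp
qed

text \<open>
  The length of the Bloch vector is differentiable only away from the centre. A trajectory passes
  through the centre only if it stays on the axis \<open>x = y = 0\<close>; there the signed coordinate \<open>z\<close>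
  replaces the length, because \<open>binary_info\<close> is even.
\<close>
lemma entropy_decay:
  assumes t: "0 \<le> t"
  shows "bloch_entropy m (x t) (y t) (z t)
    \<le> exp (- (s - sqrt (s\<^sup>2 - 2)) * t) * bloch_entropy m x0 y0 z0"
proof -
  define \<sigma> where "\<sigma> = sqrt (s\<^sup>2 - 2)"
  have "2 * 2 \<le> s * s" using s_ge_2 by (intro mult_mono) auto
  then have \<sigma>: "sqrt 2 \<le> \<sigma>" "\<sigma> \<le> s"
    using s by (auto simp: \<sigma>_def power2_eq_square intro: real_le_lsqrt)
  have \<sigma>0: "0 \<le> \<sigma>" using \<sigma>(1) by (rule order_trans[rotated]) simp
  have init: "x 0 = x0" "y 0 = y0" "z 0 = z0" by (auto simp: x_def y_def z_def)
  let ?H = "\<lambda>r t. binary_info (r t) - binary_info m - artanh m * (z t - m)"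
  show ?thesis
  proof (cases "x0 = 0 \<and> y0 = 0")
    case True
    have xy: "x u = 0" "y u = 0" for u unfolding x_def y_def using True by simp_all
    have abs: "binary_info \<bar>v\<bar> = binary_info v" for v by (cases "0 \<le> v") auto
    have "?H z t \<le> exp (- (s - \<sigma>) * t) * ?H z 0"
    proof (rule gronwall_decay[OF _ _ t])
      fix u :: real assume u: "0 \<le> u"
      have z1: "\<bar>z u\<bar> < 1"
        using ball_invariant[OF u] by (simp add: sqr_def xy abs_square_less_1)
      show "(?H z has_real_derivative - s * ((artanh (z u) - artanh m) * (z u - m))) (at u)"
        by (rule derivative_eq_intros DERIV_chain2[OF binary_info_has_derivative[OF z1] deriv_z]
            deriv_z refl | simp add: algebra_simps)+
      show "- s * ((artanh (z u) - artanh m) * (z u - m)) \<le> - (s - \<sigma>) * ?H z u"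
        using binary_info_convex_decay[OF z1 m, of "s - \<sigma>" s] s \<sigma> \<sigma>0
        by (simp add: algebra_simps)
    qed
    moreover have "bloch_entropy m (x t) (y t) (z t) = ?H z t"
      unfolding bloch_entropy_def xy by (simp add: abs)
    moreover have "bloch_entropy m x0 y0 z0 = ?H z 0"
      unfolding bloch_entropy_def init using True by (simp add: abs)
    ultimately show ?thesis unfolding \<sigma>_def by simp
  next
    case False
    define r where "r u = sqrt (sqr u)" for u
    have q0: "0 < sqr u" for u
    proof -
      have "x u \<noteq> 0 \<or> y u \<noteq> 0" unfolding x_def y_def using False by simp
      then have "0 < (x u)\<^sup>2 + (y u)\<^sup>2" by (simp add: sum_power2_gt_zero_iff)
      then show ?thesis unfolding sqr_def by (simp add: add_pos_nonneg)
    qed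
    have "?H r t \<le> exp (- (s - \<sigma>) * t) * ?H r 0"
    proof (rule gronwall_decay[OF _ _ t])
      fix u :: real assume u: "0 \<le> u"
      have r01: "0 < r u" "r u < 1" and r2: "(r u)\<^sup>2 = sqr u"
        using q0[of u] ball_invariant[OF u] by (auto simp: r_def)
      have dr: "(r has_real_derivative sqr' u / (2 * r u)) (at u)"
        unfolding r_def[abs_def] using q0[of u]
        by (auto intro!: DERIV_chain2[OF DERIV_real_sqrt deriv_sqr, THEN DERIV_cong] simp: field_simps)
      have "\<bar>r u\<bar> < 1" using r01 by simp
      note dI = DERIV_chain2[OF binary_info_has_derivative[OF this] dr]
      show "(?H r has_real_derivative artanh (r u) / r u * (sqr' u / 2) + s * artanh m * (z u - m)) (at u)"
        by (rule derivative_eq_intros dI deriv_z refl | simp add: algebra_simps)+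
      have "\<bar>z u\<bar> \<le> r u"
        by (simp add: r_def sqr_def real_le_rsqrt)
      note rad = radial_dissipation_signed[OF m r01 this s \<sigma>]
      define X where "X = (s - sqrt 2) / 2 * ((r u)\<^sup>2 - (z u)\<^sup>2) + s * z u * (z u - m)"
      have "sqr' u / 2 \<le> - X"
        using sqr'_le[of u] unfolding r2 X_def by (simp add: field_simps)
      moreover have "0 \<le> artanh (r u) / r u"
        using artanh_bounds[of "r u"] r01 by (intro divide_nonneg_pos) auto
      ultimately have "artanh (r u) / r u * (sqr' u / 2) \<le> artanh (r u) / r u * (- X)"
        by (rule mult_left_mono)
      with rad[folded X_def]
      show "artanh (r u) / r u * (sqr' u / 2) + s * artanh m * (z u - m) \<le> - (s - \<sigma>) * ?H r u"
        unfolding mult_minus_left mult_minus_right by linarith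
    qed
    then show ?thesis
      unfolding bloch_entropy_def r_def sqr_def init \<sigma>_def .
  qed
qed

end

section \<open>Clifford elements in Pauli coordinates\<close>

lemma matrix_eq_2x2:
  fixes A B :: clifford
  shows "A = B \<longleftrightarrow> A$1$1 = B$1$1 \<and> A$1$2 = B$1$2 \<and> A$2$1 = B$2$1 \<and> A$2$2 = B$2$2"
  by (auto simp: vec_eq_iff forall_2)

lemma matrix_mult_2x2:
  fixes A B :: clifford
  shows "(A ** B)$i$j = A$i$1 * B$1$j + A$i$2 * B$2$j"
  by (simp add: matrix_matrix_mult_def sum_2)

lemma cscale_nth [simp]: "cscale c A $ i $ j = c * A $ i $ j"
  by (simp add: cscale_def)

lemma adj_nth [simp]: "adj A $ i $ j = cnj (A $ j $ i)"
  by (simp add: adj_def transpose_def)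

lemma cscale_mult_left: "cscale c A ** B = cscale c (A ** B)"
  and cscale_mult_right: "A ** cscale c B = cscale c (A ** B)"
  by (simp_all add: matrix_eq_2x2 matrix_mult_2x2 algebra_simps)

lemma matrix_mult_add_left:
  fixes A B C :: clifford
  shows "(A + B) ** C = A ** C + B ** C"
  by (simp add: matrix_eq_2x2 matrix_mult_2x2 algebra_simps)

lemma cscale_cscale: "cscale c (cscale d A) = cscale (c * d) A"
  and cscale_1: "cscale 1 A = A"
  and cscale_0: "cscale 0 A = 0"
  and cscale_add: "cscale c (A + B) = cscale c A + cscale c B"
  and scaleR_cscale: "k *\<^sub>R A = cscale (complex_of_real k) A"
  by (simp_all add: matrix_eq_2x2 algebra_simps scaleR_conv_of_real[where 'a = complex])

lemma adj_mult: "adj (A ** B) = adj B ** adj A"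
  and adj_cscale: "adj (cscale c A) = cscale (cnj c) (adj A)"
  and adj_add: "adj (A + B) = adj A + adj B"
  and adj_one [simp]: "adj (mat 1) = mat 1"
  by (simp_all add: matrix_eq_2x2 matrix_mult_2x2 mat_def)

lemma ntrace_cscale: "ntrace (cscale c A) = c * ntrace A"
  and ntrace_add: "ntrace (A + B) = ntrace A + ntrace B"
  and ntrace_diff: "ntrace (A - B) = ntrace A - ntrace B"
  and ntrace_one: "ntrace (mat 1) = 1"
  by (simp_all add: ntrace_def trace_def sum_2 mat_def field_simps)

locale clifford_pair =
  fixes Q P :: clifford
  assumes generators: "clifford_generators Q P"
begin

abbreviation W :: clifford where "W \<equiv> cliff_w Q P"

text \<open>
  The coordinates of a Clifford element in the basis \<open>1, Q, P, w\<close>, which is orthonormal for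
  \<open>tr_inner\<close>. Since \<open>Q P = - \<i> w\<close>, this basis has the orientation opposite to the usual Pauli matrices.
\<close>
definition pauli :: "complex \<Rightarrow> complex \<Rightarrow> complex \<Rightarrow> complex \<Rightarrow> clifford" where
  "pauli a x y z = cscale a (mat 1) + cscale x Q + cscale y P + cscale z W"

lemma QQ: "Q ** Q = mat 1" and PP: "P ** P = mat 1" and PQ: "P ** Q = cscale (-1) (Q ** P)"
  and adjQ: "adj Q = Q" and adjP: "adj P = P"
  using generators by (auto simp: clifford_generators_def matrix_eq_2x2 add_eq_0_iff)

lemma QP: "Q ** P = cscale (- \<i>) W"
  by (simp add: cliff_w_def cscale_cscale cscale_1)

lemma QW: "Q ** W = cscale \<i> P"
  by (simp add: cliff_w_def cscale_mult_right matrix_mul_assoc QQ)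

lemma WP: "W ** P = cscale \<i> Q"
  by (simp add: cliff_w_def cscale_mult_left matrix_mul_assoc[symmetric] PP)

lemma PW: "P ** W = cscale (- \<i>) Q"
proof -
  have "P ** W = cscale \<i> (P ** Q ** P)"
    by (simp add: cliff_w_def cscale_mult_right matrix_mul_assoc)
  also have "\<dots> = cscale (- \<i>) (Q ** P ** P)"
    unfolding PQ by (simp add: cscale_mult_left cscale_cscale)
  finally show ?thesis by (simp add: matrix_mul_assoc[symmetric] PP)
qed

lemma WQ: "W ** Q = cscale (- \<i>) P"
proof -
  have "W ** Q = cscale \<i> (Q ** (P ** Q))"
    by (simp add: cliff_w_def cscale_mult_left matrix_mul_assoc)
  then show ?thesis
    unfolding PQ by (simp add: cscale_mult_right cscale_cscale matrix_mul_assoc QQ)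
qed

lemma WW: "W ** W = mat 1"
proof -
  have "W ** W = cscale \<i> (Q ** (P ** W))"
    by (subst cliff_w_def) (simp add: cscale_mult_left matrix_mul_assoc)
  then show ?thesis by (simp add: PW cscale_mult_right QQ cscale_cscale cscale_1)
qed

lemma adjW: "adj W = W"
  by (simp add: cliff_w_def adj_cscale adj_mult adjQ adjP PQ cscale_cscale)

lemma ntrace_generators: "ntrace Q = 0" "ntrace P = 0" "ntrace W = 0"
proof -
  have "P ** Q + Q ** P = 0" using generators by (simp add: clifford_generators_def)
  then show "ntrace Q = 0" "ntrace P = 0"
    using clifford_generators_traceless[OF QQ PP] clifford_generators_traceless[OF PP QQ]
    by (simp_all add: ntrace_def trace_def sum_2 add.commute)
  have "trace (P ** Q) = trace (Q ** P)" by (rule trace_mul_sym)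
  moreover have "trace (P ** Q) = - trace (Q ** P)" unfolding PQ by (simp add: trace_def sum_2)
  ultimately have "trace (Q ** P) = 0" by simp
  then show "ntrace W = 0" by (simp add: cliff_w_def ntrace_cscale) (simp add: ntrace_def)
qed

lemma pauli_mult:
  "pauli a x y z ** pauli a' x' y' z' =
    pauli (a * a' + x * x' + y * y' + z * z')
      (a * x' + x * a' - \<i> * (y * z' - z * y'))
      (a * y' + y * a' - \<i> * (z * x' - x * z'))
      (a * z' + z * a' - \<i> * (x * y' - y * x'))"
proof -
  have PQ': "P ** Q = cscale \<i> W" using PQ by (simp add: QP cscale_cscale)
  show ?thesis
    unfolding pauli_def
    apply (simp only: matrix_add_ldistrib matrix_mult_add_left cscale_mult_left cscale_mult_right
        cscale_cscale cscale_add QQ PP WW QP PQ' QW WQ PW WP matrix_mul_lid matrix_mul_rid)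
    apply (simp only: matrix_eq_2x2 vector_add_component cscale_nth)
    apply (intro conjI; simp add: algebra_simps)
    done
qed

lemma pauli_add: "pauli a x y z + pauli a' x' y' z' = pauli (a + a') (x + x') (y + y') (z + z')"
  and pauli_diff: "pauli a x y z - pauli a' x' y' z' = pauli (a - a') (x - x') (y - y') (z - z')"
  and cscale_pauli: "cscale c (pauli a x y z) = pauli (c * a) (c * x) (c * y) (c * z)"
  and adj_pauli: "adj (pauli a x y z) = pauli (cnj a) (cnj x) (cnj y) (cnj z)"
  by (simp_all add: pauli_def adj_add adj_cscale adj_one adjQ adjP adjW)
     (simp_all add: matrix_eq_2x2 algebra_simps)

lemma scaleR_pauli: "k *\<^sub>R pauli a x y z = pauli (k * a) (k * x) (k * y) (k * z)"
  by (simp add: scaleR_cscale cscale_pauli)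

lemma ntrace_pauli: "ntrace (pauli a x y z) = a"
  by (simp add: pauli_def ntrace_add ntrace_cscale ntrace_one ntrace_generators)

lemma tr_inner_pauli:
  "tr_inner (pauli a x y z) (pauli a' x' y' z') = a * cnj a' + x * cnj x' + y * cnj y' + z * cnj z'"
  by (simp add: tr_inner_def adj_pauli pauli_mult ntrace_pauli mult.commute)

lemma pauli_cases: obtains a x y z where "X = pauli a x y z"
proof -
  obtain c0 c1 c2 c3 where "X = cscale c0 (mat 1) + cscale c1 Q + cscale c2 P + cscale c3 (Q ** P)"
    using clifford_generators_span[OF generators, of X] by blast
  then have "X = pauli c0 c1 c2 (c3 * - \<i>)"
    by (simp add: pauli_def QP cscale_cscale)
  then show thesis by (rule that)
qed

text \<open>Testing against the orthonormal basis recovers every coordinate.\<close>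
lemma tr_inner_nondegenerate:
  assumes "\<And>X. tr_inner X Y = tr_inner X Z" shows "Y = Z"
proof -
  obtain a x y z a' x' y' z' where YZ: "Y = pauli a x y z" "Z = pauli a' x' y' z'"
    by (metis pauli_cases)
  then show ?thesis
    using assms[of "pauli 1 0 0 0"] assms[of "pauli 0 1 0 0"] assms[of "pauli 0 0 1 0"]
      assms[of "pauli 0 0 0 1"]
    by (simp add: tr_inner_pauli)
qed

lemma pauli_eq_iff: "pauli a x y z = pauli a' x' y' z' \<longleftrightarrow> a = a' \<and> x = x' \<and> y = y' \<and> z = z'"
proof
  assume eq: "pauli a x y z = pauli a' x' y' z'"
  have "tr_inner (pauli a x y z) B = tr_inner (pauli a' x' y' z') B" for B
    by (simp add: eq)
  from this[of "pauli 1 0 0 0"] this[of "pauli 0 1 0 0"] this[of "pauli 0 0 1 0"]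
      this[of "pauli 0 0 0 1"]
  show "a = a' \<and> x = x' \<and> y = y' \<and> z = z'" by (simp add: tr_inner_pauli)
qed auto

lemma one_eq_pauli: "mat 1 = pauli 1 0 0 0"
  by (simp add: pauli_def cscale_0 cscale_1)

lemma tr_adjoint_eqI:
  assumes "\<And>X Y. tr_inner (T X) Y = tr_inner X (S Y)"
  shows "tr_adjoint T = S"
  unfolding tr_adjoint_def
proof (rule the_equality)
  fix S' assume "\<forall>x y. tr_inner (T x) y = tr_inner x (S' y)"
  then show "S' = S" using assms by (metis ext tr_inner_nondegenerate)
qed (use assms in blast)

lemma self_adjoint_pauli:
  assumes "adj X = X"
  obtains a x y z where "X = pauli (complex_of_real a) (complex_of_real x) (complex_of_real y) (complex_of_real z)"
proof -
  obtain a x y z where X: "X = pauli a x y z" by (rule pauli_cases)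
  with assms have "cnj a = a" "cnj x = x" "cnj y = y" "cnj z = z"
    by (simp_all add: adj_pauli pauli_eq_iff)
  then have "a = complex_of_real (Re a)" "x = complex_of_real (Re x)"
     "y = complex_of_real (Re y)" "z = complex_of_real (Re z)"
    by (simp_all add: complex_eq_iff)
  with X show thesis using that by metis
qed

lemma cliff_v_pauli:
  "cliff_v Q P = pauli 0 (- complex_of_real (1 / sqrt 2)) (- \<i> * complex_of_real (1 / sqrt 2)) 0"
proof -
  have "Q = pauli 0 1 0 0" "P = pauli 0 0 1 0" "W = pauli 0 0 0 1"
    by (simp_all add: pauli_def cscale_0 cscale_1)
  then have "cliff_v Q P = pauli 0 0 0 1 ** ((1 / sqrt 2) *\<^sub>R (pauli 0 1 0 0 + cscale \<i> (pauli 0 0 1 0)))"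
    by (metis cliff_v_def cliff_z_def)
  then show ?thesis
    by (simp add: cscale_pauli scaleR_pauli pauli_add pauli_mult pauli_eq_iff)
qed

lemma sqrt_half_square: "complex_of_real (1 / sqrt 2) * complex_of_real (1 / sqrt 2) = 1 / 2"
  by (simp flip: of_real_mult)

text \<open>
  The element \<open>v\<close> equals \<open>- (Q + \<i> P) / sqrt 2\<close>: up to the factor \<open>- sqrt 2\<close> it is a matrix unit that maps
  the eigenspace \<open>w = 1\<close> to \<open>w = -1\<close>. The first two identities therefore move diagonal entries with
  respect to \<open>w\<close>, while the third exchanges the off-diagonal ones; that is what
  makes the rates of \<open>Q\<close> and \<open>P\<close> different.
\<close>
lemma jump_pauli:
  fixes v defines "v \<equiv> cliff_v Q P"
  shows "adj v ** pauli a x y z ** v = pauli (a - z) 0 0 (a - z)"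
    and "v ** pauli a x y z ** adj v = pauli (a + z) 0 0 (- a - z)"
    and "v ** pauli a x y z ** v + adj v ** pauli a x y z ** adj v = pauli 0 (2 * x) (- 2 * y) 0"
proof -
  define c where "c = complex_of_real (1 / sqrt 2)"
  have v: "v = pauli 0 (- c) (- \<i> * c) 0" by (simp add: v_def cliff_v_pauli c_def)
  have v': "adj v = pauli 0 (- c) (\<i> * c) 0" unfolding v by (simp add: adj_pauli c_def)
  have cc: "c * c = 1 / 2" unfolding c_def by (rule sqrt_half_square)
  have cc': "c * (c * u) = u / 2" for u
    by (simp only: mult.assoc[symmetric] cc) simp
  show "adj v ** pauli a x y z ** v = pauli (a - z) 0 0 (a - z)"
    unfolding v' unfolding v pauli_mult pauli_eq_iff by (simp add: algebra_simps cc cc')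
  show "v ** pauli a x y z ** adj v = pauli (a + z) 0 0 (- a - z)"
    unfolding v' unfolding v pauli_mult pauli_eq_iff by (simp add: algebra_simps cc cc')
  show "v ** pauli a x y z ** v + adj v ** pauli a x y z ** adj v = pauli 0 (2 * x) (- 2 * y) 0"
    unfolding v' unfolding v pauli_mult pauli_add pauli_eq_iff by (simp add: algebra_simps cc cc')
qed

lemma cliff_y_pauli:
  "cliff_y Q P \<mu> = pauli (complex_of_real ((\<mu> + inverse \<mu>) / 2)) 0 0 (complex_of_real ((inverse \<mu> - \<mu>) / 2))"
  using jump_pauli(1,2)[of 1 0 0 0]
  by (simp add: cliff_y_def Let_def one_eq_pauli[symmetric])
     (simp add: scaleR_pauli pauli_add pauli_eq_iff field_simps)

lemma generator_pauli:
  assumes "0 < \<mu>"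
  defines "s \<equiv> \<mu> + inverse \<mu>"
  defines "m \<equiv> (\<mu> - inverse \<mu>) / s"
  shows "generator Q P \<gamma> \<mu> (pauli a x y z) =
    pauli (- complex_of_real (m * s) * z) (complex_of_real (s / 2 - \<gamma>) * x)
      (complex_of_real (s / 2 + \<gamma>) * y) (complex_of_real s * z)"
proof -
  define i where "i = inverse \<mu>"
  have ms: "m * s = \<mu> - inverse \<mu>" using assms by (simp add: m_def add_pos_pos less_imp_neq[symmetric])
  show ?thesis
    unfolding generator_def Let_def jump_pauli cliff_y_pauli ms
    by (simp add: pauli_mult scaleR_pauli pauli_add pauli_diff pauli_eq_iff s_def
        i_def[symmetric] del: of_real_inverse)
       (simp add: field_simps)
qed

lemma cliff_rho_pauli:
  assumes "0 < \<mu>"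
  shows "cliff_rho Q P \<mu> = pauli 1 0 0 (complex_of_real ((\<mu> - inverse \<mu>) / (\<mu> + inverse \<mu>)))"
proof -
  let ?B = "pauli (complex_of_real ((\<mu> + inverse \<mu>) / 2)) 0 0 (complex_of_real ((\<mu> - inverse \<mu>) / 2))"
  have 1: "cliff_y Q P \<mu> ** ?B = mat 1" "?B ** cliff_y Q P \<mu> = mat 1"
    using assms by (simp_all add: cliff_y_pauli pauli_mult one_eq_pauli pauli_eq_iff field_simps)
  then have "matrix_inv (cliff_y Q P \<mu>) = ?B"
    unfolding matrix_inv_def by (metis (mono_tags, lifting) matrix_mul_assoc matrix_mul_lid matrix_mul_rid someI_ex)
  moreover define s d where "s = \<mu> + inverse \<mu>" and "d = \<mu> - inverse \<mu>"
  moreover have "s \<noteq> 0" using assms by (simp add: s_def add_pos_pos less_imp_neq[symmetric])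
  ultimately show ?thesis
    unfolding cliff_rho_def s_def[symmetric] d_def[symmetric]
    by (simp add: scaleR_pauli pauli_eq_iff)
qed

end

section \<open>Functional calculus of two-by-two self-adjoint matrices\<close>

lemma unitary_conj_lincomb:
  assumes "adj U ** U = mat 1"
  shows "U ** (cscale a (mat 1) + cscale b X) ** adj U = cscale a (mat 1) + cscale b (U ** X ** adj U)"
proof -
  have "U ** adj U = mat 1" using assms by (simp add: matrix_left_right_inverse)
  then show ?thesis
    by (simp add: matrix_add_ldistrib matrix_mult_add_left cscale_mult_left cscale_mult_right)
qed

lemma trace_unitary_conj:
  assumes "adj U ** U = mat 1"
  shows "trace (U ** X ** adj U) = trace X"
  by (metis assms matrix_mul_assoc matrix_mul_lid trace_mul_sym)

lemma real_diag_nth [simp]: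
  "real_diag d $ 1 $ 1 = complex_of_real (d $ 1)" "real_diag d $ 2 $ 2 = complex_of_real (d $ 2)"
  "real_diag d $ 1 $ 2 = 0" "real_diag d $ 2 $ 1 = 0"
  by (simp_all add: real_diag_def)

text \<open>
  Such a matrix has the rows \<open>(p, q)\<close> and \<open>(cnj q, - p)\<close>, with eigenvalues \<open>R\<close> and \<open>- R\<close>. The vector
  \<open>(p + R, cnj q)\<close> spans the eigenspace of \<open>R\<close>; its squared length is \<open>2 R (p + R)\<close>. It vanishes
  only if \<open>p = - R\<close>, and then \<open>q = 0\<close> and the matrix is already diagonal.
\<close>
lemma hermitian_2x2_diagonalisable:
  fixes N :: clifford
  assumes "adj N = N" "trace N = 0" "N ** N = cscale (complex_of_real (r\<^sup>2)) (mat 1)"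
  shows "\<exists>U d. adj U ** U = mat 1 \<and> N = U ** real_diag d ** adj U"
proof -
  define p q where "p = Re (N$1$1)" and "q = N$1$2"
  have N11: "N$1$1 = complex_of_real p"
    using assms(1) by (simp add: matrix_eq_2x2 p_def complex_eq_iff)
  have N22: "N$2$2 = - complex_of_real p"
    using assms(2) N11 by (simp add: trace_def sum_2 eq_neg_iff_add_eq_0 add.commute)
  have N21: "N$2$1 = cnj q" using assms(1) by (simp add: matrix_eq_2x2 q_def)
  define R where "R = sqrt (p\<^sup>2 + (cmod q)\<^sup>2)"
  have R2: "R\<^sup>2 = p\<^sup>2 + (cmod q)\<^sup>2" and R: "0 \<le> R" "\<bar>p\<bar> \<le> R"
    by (simp_all add: R_def real_le_rsqrt)
  have R2': "complex_of_real R * complex_of_real R = complex_of_real p * complex_of_real p + q * cnj q"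
    unfolding complex_norm_square[symmetric] using R2
    by (simp add: power2_eq_square flip: of_real_mult of_real_add)
  show ?thesis
  proof (cases "p + R = 0")
    case True
    then have "q = 0" using R2 by (simp add: add_eq_0_iff)
    then have "N = mat 1 ** real_diag (vector [p, -p]) ** adj (mat 1)"
      using N11 N22 N21 by (simp add: matrix_eq_2x2 q_def)
    then show ?thesis by (metis adj_one matrix_mul_lid)
  next
    case False
    define k where "k = 1 / sqrt (2 * R * (p + R))"
    have pos: "0 < 2 * R * (p + R)" using False R by (intro mult_pos_pos) linarith+
    define V :: clifford where "V = vector [vector [complex_of_real (p + R), - q], vector [cnj q, complex_of_real (p + R)]]"
    define U where "U = cscale (complex_of_real k) V"
    have kk: "complex_of_real k * (complex_of_real k * complex_of_real (2 * R * (p + R))) = 1"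
    proof -
      have "k * (k * X) = 1" if "X = 2 * R * (p + R)" for X
        unfolding k_def that[symmetric] using pos[folded that] by simp
      then show ?thesis by (simp only: of_real_mult[symmetric] of_real_1)
    qed
    have adjU: "adj U = cscale (complex_of_real k) (adj V)" by (simp add: U_def adj_cscale)
    have VV: "adj V ** V = cscale (complex_of_real (2 * R * (p + R))) (mat 1)"
      unfolding matrix_eq_2x2 matrix_mult_2x2 cscale_nth adj_nth
      using R2' by (simp add: V_def mat_def) algebra
    have VN: "V ** real_diag (vector [R, -R]) ** adj V = cscale (complex_of_real (2 * R * (p + R))) N"
      unfolding matrix_eq_2x2 matrix_mult_2x2 cscale_nth adj_nth
      using R2' by (simp add: V_def N11 N22 N21 q_def[symmetric]) (intro conjI; algebra)
    have "adj U ** U = mat 1"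
      unfolding adjU unfolding U_def
      by (simp only: cscale_mult_left cscale_mult_right cscale_cscale VV kk cscale_1)
    moreover have "N = U ** real_diag (vector [R, -R]) ** adj U"
      unfolding adjU unfolding U_def
      by (simp only: cscale_mult_left cscale_mult_right cscale_cscale VN kk cscale_1)
    ultimately show ?thesis by blast
  qed
qed

text \<open>
  The eigenvalues of \<open>c + N\<close> are \<open>c + r\<close> and \<open>c - r\<close>: the trace and the trace of the square determine
  them up to order, whatever the diagonalisation. Hence \<open>f\<close> may be replaced by the affine function
  that interpolates it at these two points, which shows that the value is independent of the
  diagonalisation. For \<open>r = 0\<close> the interpolating slope is \<open>0 / 0 = 0\<close> and the formula remains true.
\<close>
lemma fun_calc_2x2:
  fixes N :: clifford and c r :: real
  assumes N: "adj N = N" "trace N = 0" "N ** N = cscale (complex_of_real (r\<^sup>2)) (mat 1)"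
  shows "fun_calc f (cscale (complex_of_real c) (mat 1) + N) =
    cscale (complex_of_real ((f (c + r) + f (c - r)) / 2)) (mat 1) +
    cscale (complex_of_real ((f (c + r) - f (c - r)) / (2 * r))) N"
    (is "fun_calc f ?A = cscale ?\<alpha> (mat 1) + cscale ?\<beta> N")
  unfolding fun_calc_def
proof (rule the_equality)
  have lincomb: "U ** real_diag (\<chi> i. f (d $ i)) ** adj U = cscale ?\<alpha> (mat 1) + cscale ?\<beta> N"
    if U: "adj U ** U = mat 1" and A: "?A = U ** real_diag d ** adj U" for U d
  proof -
    have "trace (real_diag d) = trace ?A"
      unfolding A using trace_unitary_conj[OF U] by simp
    moreover have "trace ?A = 2 * complex_of_real c"
      using N(2) by (simp add: trace_def sum_2 mat_def)
    ultimately have "complex_of_real (d$1 + d$2) = complex_of_real (2 * c)"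
      by (simp add: trace_def sum_2)
    then have e1: "d$1 + d$2 = 2 * c" by (simp only: of_real_eq_iff)
    have "?A ** ?A = U ** (real_diag d ** real_diag d) ** adj U"
      unfolding A by (metis U matrix_mul_assoc matrix_mul_rid)
    then have "trace (real_diag d ** real_diag d) = trace (?A ** ?A)"
      using trace_unitary_conj[OF U] by simp
    also have "?A ** ?A = cscale (complex_of_real (c\<^sup>2 + r\<^sup>2)) (mat 1) + cscale (complex_of_real (2 * c)) N"
      by (simp add: matrix_add_ldistrib matrix_mult_add_left cscale_mult_left cscale_mult_right N(3))
         (simp add: matrix_eq_2x2 algebra_simps power2_eq_square)
    also have "trace \<dots> = complex_of_real (2 * (c\<^sup>2 + r\<^sup>2)) + complex_of_real (2 * c) * trace N"
      by (simp add: trace_def sum_2 mat_def algebra_simps)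
    finally have "complex_of_real (d$1 * d$1 + d$2 * d$2) = complex_of_real (2 * (c\<^sup>2 + r\<^sup>2))"
      using N(2) by (simp add: trace_def sum_2 matrix_mult_2x2)
    then have "d$1 * d$1 + d$2 * d$2 = 2 * (c\<^sup>2 + r\<^sup>2)" by (simp only: of_real_eq_iff)
    moreover have "d$2 = 2 * c - d$1" using e1 by simp
    ultimately have "(d$1 - c)\<^sup>2 = r\<^sup>2" by (simp add: power2_eq_square algebra_simps)
    then have "d$1 - c = r \<or> d$1 - c = - r" by (simp add: power2_eq_iff)
    then have d: "d$1 = c + r \<and> d$2 = c - r \<or> d$1 = c - r \<and> d$2 = c + r"
      using e1 by auto
    define \<alpha> \<beta> where "\<alpha> = (f (c + r) + f (c - r)) / 2" and "\<beta> = (f (c + r) - f (c - r)) / (2 * r)"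
    have "f (c + r) = \<alpha> + \<beta> * r" "f (c - r) = \<alpha> - \<beta> * r"
      by (cases "r = 0"; simp add: \<alpha>_def \<beta>_def field_simps)+
    then have "f (d$1) = (\<alpha> - \<beta> * c) + \<beta> * d$1" "f (d$2) = (\<alpha> - \<beta> * c) + \<beta> * d$2"
      using d by (auto simp: algebra_simps)
    then have "real_diag (\<chi> i. f (d $ i)) =
        cscale (complex_of_real (\<alpha> - \<beta> * c)) (mat 1) + cscale (complex_of_real \<beta>) (real_diag d)"
      by (simp add: matrix_eq_2x2 mat_def)
    then have "U ** real_diag (\<chi> i. f (d $ i)) ** adj U =
        cscale (complex_of_real (\<alpha> - \<beta> * c)) (mat 1) + cscale (complex_of_real \<beta>) ?A"
      unfolding A by (simp add: unitary_conj_lincomb[OF U])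
    also have "\<dots> = cscale (complex_of_real \<alpha>) (mat 1) + cscale (complex_of_real \<beta>) N"
      by (simp add: matrix_eq_2x2 algebra_simps)
    finally show ?thesis unfolding \<alpha>_def \<beta>_def .
  qed
  obtain U d where U: "adj U ** U = mat 1" and d: "N = U ** real_diag d ** adj U"
    using hermitian_2x2_diagonalisable[OF N] by blast
  have "real_diag (\<chi> i. c + d $ i) = cscale (complex_of_real c) (mat 1) + cscale 1 (real_diag d)"
    by (simp add: matrix_eq_2x2 mat_def)
  then have "?A = U ** real_diag (\<chi> i. c + d $ i) ** adj U"
    by (simp only: unitary_conj_lincomb[OF U] d[symmetric]) (simp add: cscale_1)
  with U lincomb[OF U this]
  show "\<exists>U d. adj U ** U = mat 1 \<and> ?A = U ** real_diag d ** adj U \<and>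
      cscale ?\<alpha> (mat 1) + cscale ?\<beta> N = U ** real_diag (\<chi> i. f (d $ i)) ** adj U"
    by metis
  show "B = cscale ?\<alpha> (mat 1) + cscale ?\<beta> N"
    if "\<exists>U d. adj U ** U = mat 1 \<and> ?A = U ** real_diag d ** adj U \<and>
      B = U ** real_diag (\<chi> i. f (d $ i)) ** adj U" for B
    using that lincomb by metis
qed

section \<open>Semigroup and relative entropy in Pauli coordinates\<close>

lemma cscale_sums:
  assumes "f sums c" shows "(\<lambda>n. cscale (f n) A) sums cscale c A"
proof (rule bounded_linear.sums[OF _ assms])
  have "linear (\<lambda>c. cscale c A)"
    by (rule linearI) (simp_all add: matrix_eq_2x2 algebra_simps)
  then show "bounded_linear (\<lambda>c. cscale c A)" by (simp add: linear_conv_bounded_linear)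
qed

lemma exp_sums_complex:
  "(\<lambda>n. complex_of_real ((- t) ^ n / fact n) * (complex_of_real l ^ n * x)) sums
    (complex_of_real (exp (- l * t)) * x)"
proof -
  have "(\<lambda>n. (- t * l) ^ n /\<^sub>R fact n) sums exp (- t * l)" by (rule exp_converges)
  from sums_mult2[OF sums_of_real[OF this], of x]
  have "(\<lambda>n. complex_of_real ((- t * l) ^ n /\<^sub>R fact n) * x) sums (complex_of_real (exp (- t * l)) * x)" .
  moreover have "complex_of_real ((- t * l) ^ n /\<^sub>R fact n) * x
      = complex_of_real ((- t) ^ n / fact n) * (complex_of_real l ^ n * x)" for n
    unfolding power_mult_distrib by (simp add: divide_inverse mult_ac)
  ultimately show ?thesis by (simp add: mult.commute)
qed

context clifford_pair
begin

lemma pauli_sums: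
  assumes "f sums a" "g sums x" "h sums y" "k sums z"
  shows "(\<lambda>n. pauli (f n) (g n) (h n) (k n)) sums pauli a x y z"
  unfolding pauli_def by (intro sums_add cscale_sums assms)

text \<open>
  The generator is diagonal apart from its contribution \<open>- m s z\<close> to the coefficient of \<open>1\<close>. Every
  positive power contributes \<open>- m s\<^sup>n z\<close> there, and writing the zeroth one as \<open>(a + m z) - m z\<close> makes
  the series of that coefficient exponential as well.
\<close>
lemma exp_semigroup_pauli:
  assumes L: "\<And>a x y z. L (pauli a x y z) = pauli (- complex_of_real (m * s) * z)
      (complex_of_real l * x) (complex_of_real l' * y) (complex_of_real s * z)"
  shows "exp_semigroup L t (pauli a x y z) =
    pauli (a + complex_of_real (m * (1 - exp (- s * t))) * z) (complex_of_real (exp (- l * t)) * x)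
      (complex_of_real (exp (- l' * t)) * y) (complex_of_real (exp (- s * t)) * z)"
proof -
  define M where "M = complex_of_real m"
  have iter: "(L ^^ n) (pauli a x y z) = pauli ((if n = 0 then a + M * z else 0) - complex_of_real s ^ n * (M * z))
     (complex_of_real l ^ n * x) (complex_of_real l' ^ n * y) (complex_of_real s ^ n * z)" for n
    by (induction n) (simp_all add: L pauli_eq_iff M_def)
  define c where "c n = complex_of_real ((- t) ^ n / fact n)" for n
  have "(\<lambda>n. if n = 0 then a + M * z else 0) sums (a + M * z)"
    using sums_single[of 0 "\<lambda>_. a + M * z"] by simp
  from sums_diff[OF this exp_sums_complex[of t s "M * z"]]
  have first: "(\<lambda>n. c n * ((if n = 0 then a + M * z else 0) - complex_of_real s ^ n * (M * z))) sums
      (a + M * z - complex_of_real (exp (- s * t)) * (M * z))"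
    by (rule back_subst[where P = "\<lambda>f. f sums _"]) (auto simp: c_def algebra_simps)
  have "(\<lambda>n. ((- t) ^ n / fact n) *\<^sub>R (L ^^ n) (pauli a x y z)) sums
     pauli (a + M * z - complex_of_real (exp (- s * t)) * (M * z)) (complex_of_real (exp (- l * t)) * x)
      (complex_of_real (exp (- l' * t)) * y) (complex_of_real (exp (- s * t)) * z)"
    unfolding iter scaleR_pauli
    using pauli_sums[OF first[unfolded c_def] exp_sums_complex exp_sums_complex exp_sums_complex] by simp
  then have "exp_semigroup L t (pauli a x y z) =
     pauli (a + M * z - complex_of_real (exp (- s * t)) * (M * z)) (complex_of_real (exp (- l * t)) * x)
      (complex_of_real (exp (- l' * t)) * y) (complex_of_real (exp (- s * t)) * z)"
    unfolding exp_semigroup_def by (rule sums_unique[symmetric])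
  then show ?thesis by (simp add: M_def algebra_simps)
qed

text \<open>
  In the orthonormal basis \<open>1, Q, P, w\<close> the map has a real matrix, so that its adjoint is the transpose.
\<close>
lemma tr_adjoint_pauli:
  assumes T: "\<And>a x y z. T (pauli a x y z) = pauli (a + complex_of_real k * z)
      (complex_of_real e1 * x) (complex_of_real e2 * y) (complex_of_real e3 * z)"
  shows "tr_adjoint T (pauli a x y z) = pauli a (complex_of_real e1 * x)
      (complex_of_real e2 * y) (complex_of_real e3 * z + complex_of_real k * a)"
proof -
  \<comment> \<open>Coordinates are unique, so a description in terms of them defines a map on all matrices.\<close>
  define S where "S X = (THE Y. \<forall>a x y z. X = pauli a x y z \<longrightarrow> Y = pauli a (complex_of_real e1 * x)
      (complex_of_real e2 * y) (complex_of_real e3 * z + complex_of_real k * a))" for X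
  have S: "S (pauli a x y z) = pauli a (complex_of_real e1 * x)
      (complex_of_real e2 * y) (complex_of_real e3 * z + complex_of_real k * a)" for a x y z
    unfolding S_def pauli_eq_iff by simp
  have "tr_adjoint T = S"
  proof (rule tr_adjoint_eqI)
    fix X Y
    obtain a x y z a' x' y' z' where "X = pauli a x y z" "Y = pauli a' x' y' z'"
      by (metis pauli_cases)
    then show "tr_inner (T X) Y = tr_inner X (S Y)"
      by (simp add: T S tr_inner_pauli algebra_simps)
  qed
  then show ?thesis by (simp add: S)
qed

lemma op_log_pauli:
  fixes x y z :: real
  defines "r \<equiv> sqrt (x\<^sup>2 + y\<^sup>2 + z\<^sup>2)"
  assumes "r < 1"
  shows "op_log (pauli 1 x y z) = pauli (complex_of_real ((ln (1 + r) + ln (1 - r)) / 2))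
    (complex_of_real (artanh r / r * x)) (complex_of_real (artanh r / r * y)) (complex_of_real (artanh r / r * z))"
proof -
  let ?N = "pauli 0 x y z"
  have r2: "r\<^sup>2 = x\<^sup>2 + y\<^sup>2 + z\<^sup>2" and r0: "0 \<le> r" by (simp_all add: r_def)
  have "ntrace ?N = 0" by (simp add: ntrace_pauli)
  then have N: "adj ?N = ?N" "trace ?N = 0" "?N ** ?N = cscale (complex_of_real (r\<^sup>2)) (mat 1)"
    unfolding r2 one_eq_pauli
    by (simp_all add: ntrace_def adj_pauli pauli_mult cscale_pauli pauli_eq_iff power2_eq_square)
  have "pauli 1 x y z = cscale (complex_of_real 1) (mat 1) + ?N"
    unfolding one_eq_pauli by (simp add: cscale_pauli pauli_add)
  moreover have "(ln (1 + r) - ln (1 - r)) / (2 * r) = artanh r / r"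
  proof -
    have "ln (1 + r) - ln (1 - r) = 2 * artanh r" using artanh_eq_ln_diff[of r] r0 assms(2) by simp
    then show ?thesis by simp
  qed
  ultimately show ?thesis
    unfolding op_log_def using fun_calc_2x2[OF N, of ln 1]
    unfolding one_eq_pauli by (simp add: cscale_pauli pauli_add)
qed

lemma rel_entropy_pauli:
  fixes x y z m :: real
  assumes r: "x\<^sup>2 + y\<^sup>2 + z\<^sup>2 < 1" and m: "\<bar>m\<bar> < 1"
  shows "rel_entropy (pauli 1 x y z) (pauli 1 0 0 m) = bloch_entropy m x y z"
proof -
  define r where "r = sqrt (x\<^sup>2 + y\<^sup>2 + z\<^sup>2)"
  have r1: "0 \<le> r" "r < 1" and r2: "r\<^sup>2 = x\<^sup>2 + y\<^sup>2 + z\<^sup>2" using r by (simp_all add: r_def)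
  have rr: "artanh r / r * x * x + artanh r / r * y * y + artanh r / r * z * z = r * artanh r"
  proof -
    have "artanh r / r * x * x + artanh r / r * y * y + artanh r / r * z * z = artanh r / r * r\<^sup>2"
      unfolding r2 by (simp add: power2_eq_square algebra_simps)
    then show ?thesis by (simp add: power2_eq_square)
  qed
  have mm: "artanh \<bar>m\<bar> / \<bar>m\<bar> * m = artanh m"
    using m artanh_minus_real[of m] by (cases "m = 0"; cases "m > 0") auto
  have mln: "ln (1 + \<bar>m\<bar>) + ln (1 - \<bar>m\<bar>) = ln (1 + m) + ln (1 - m)"
    by (cases "m \<ge> 0") auto
  have logD: "op_log (pauli 1 x y z) = pauli (complex_of_real ((ln (1 + r) + ln (1 - r)) / 2))
    (complex_of_real (artanh r / r * x)) (complex_of_real (artanh r / r * y)) (complex_of_real (artanh r / r * z))"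
    using op_log_pauli[of x y z] r1 by (simp add: r_def)
  have logR: "op_log (pauli 1 0 0 m) = pauli (complex_of_real ((ln (1 + m) + ln (1 - m)) / 2))
    0 0 (complex_of_real (artanh m))"
  proof -
    have "sqrt (0\<^sup>2 + 0\<^sup>2 + m\<^sup>2) = \<bar>m\<bar>" by simp
    from op_log_pauli[of 0 0 m, unfolded this, OF m] show ?thesis
      by (simp only: mm mln mult_zero_right of_real_0)
  qed
  have "rel_entropy (pauli 1 x y z) (pauli 1 0 0 m) =
      ((ln (1 + r) + ln (1 - r)) / 2 + (artanh r / r * x * x + artanh r / r * y * y + artanh r / r * z * z))
      - ((ln (1 + m) + ln (1 - m)) / 2 + artanh m * z)"
    unfolding rel_entropy_def ntrace_diff logD logR pauli_mult ntrace_pauli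
    by (simp add: algebra_simps)
  then show ?thesis
    unfolding rr bloch_entropy_def r_def[symmetric]
    using r1 m by (simp add: binary_info_eq_artanh algebra_simps)
qed

text \<open>
  The eigenvalues of \<open>D\<close> have the product \<open>d = 1 - (x\<^sup>2 + y\<^sup>2 + z\<^sup>2)\<close>, which is the determinant. Its
  positivity is read off from the quadratic form at a vector \<open>u\<close> that \<open>D\<close> maps to a multiple of the
  second unit vector.
\<close>
lemma strictly_pos_density_pauli:
  assumes "density_operator D" "strictly_pos_op D"
  obtains x y z :: real where "D = pauli 1 x y z" "x\<^sup>2 + y\<^sup>2 + z\<^sup>2 < 1"
proof -
  have "adj D = D" and nt: "ntrace D = 1"
    using assms by (auto simp: density_operator_def nonneg_op_def)
  then obtain a x y z where "D = pauli (complex_of_real a) (complex_of_real x) (complex_of_real y) (complex_of_real z)"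
    using self_adjoint_pauli by blast
  with nt have D: "D = pauli 1 x y z" by (simp add: ntrace_pauli)
  \<comment> \<open>The Cayley-Hamilton equation of \<open>D\<close> identifies \<open>d\<close> with the determinant.\<close>
  define d where "d = 1 - (x\<^sup>2 + y\<^sup>2 + z\<^sup>2)"
  have "D ** D = cscale 2 D - cscale (complex_of_real d) (mat 1)"
    unfolding D one_eq_pauli d_def
    by (simp add: pauli_mult cscale_pauli pauli_diff pauli_eq_iff power2_eq_square)
  moreover have tr: "D$1$1 + D$2$2 = 2" using nt by (simp add: ntrace_def trace_def sum_2)
  ultimately have det: "D$1$1 * D$2$2 - D$2$1 * D$1$2 = complex_of_real d"
    by (auto simp: matrix_eq_2x2 matrix_mult_2x2 mat_def algebra_simps) (simp add: algebra_simps flip: tr)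
  have form: "0 < Re (cnj (u$1) * (D$1$1 * u$1 + D$1$2 * u$2) + cnj (u$2) * (D$2$1 * u$1 + D$2$2 * u$2))"
    if "u \<noteq> 0" for u :: "complex^2"
    using assms(2) that by (auto simp: strictly_pos_op_def matrix_vector_mult_def sum_2)
  define e :: "complex^2" where "e = vector [1, 0]"
  have "e$1 = 1" "e$2 = 0" by (simp_all add: e_def)
  moreover from this have "e \<noteq> 0" by (metis zero_index one_neq_zero)
  ultimately have pos: "0 < Re (D$1$1)" using form[of e] by simp
  define u :: "complex^2" where "u = vector [- D$1$2, D$1$1]"
  have u: "u$1 = - D$1$2" "u$2 = D$1$1" by (simp_all add: u_def)
  have "u \<noteq> 0" using u pos by (metis zero_index less_irrefl zero_complex.simps(1))
  from form[OF this]
  have "0 < Re (cnj (D$1$1) * (D$1$1 * D$2$2 - D$2$1 * D$1$2))"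
    unfolding u by (simp add: algebra_simps)
  then have "0 < Re (D$1$1) * d" unfolding det by simp
  then have "0 < d" using pos by (simp add: zero_less_mult_iff)
  then show thesis using D that by (simp add: d_def)
qed

end

theorem theorem9p4:
  fixes Q P :: clifford and a b \<gamma> \<mu> \<beta> :: real
    and \<Phi> :: "real \<Rightarrow> clifford \<Rightarrow> clifford" and \<rho> :: clifford
  assumes "clifford_generators Q P"
    and "a > 0" and "b > 0" and "a + b = 1" and "\<gamma> = b - a" and "\<mu> > 0"
    and "\<Phi> = exp_semigroup (generator Q P \<gamma> \<mu>)"
    and "\<rho> = cliff_rho Q P \<mu>"
    and "\<bar>\<gamma>\<bar> \<le> sqrt 2 / 2"
    and "\<beta> = ((\<mu> + inverse \<mu>) - sqrt (\<mu>^2 + inverse \<mu>^2)) / 2"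
  shows "\<forall>D t. density_operator D \<longrightarrow> strictly_pos_op D \<longrightarrow> t \<ge> 0 \<longrightarrow>
           rel_entropy (tr_adjoint (\<Phi> t) D) \<rho> \<le> exp (- 2 * \<beta> * t) * rel_entropy D \<rho>"
proof (intro allI impI)
  fix D t assume D: "density_operator D" "strictly_pos_op D" and t: "0 \<le> (t::real)"
  interpret clifford_pair Q P using assms(1) by unfold_locales
  define s m where "s = \<mu> + inverse \<mu>" and "m = (\<mu> - inverse \<mu>) / s"
  have s0: "0 < s" and i0: "0 < inverse \<mu>" using assms by (simp_all add: s_def add_pos_pos)
  have mu1: "\<mu> * inverse \<mu> = 1" using assms by simp
  have "m * s = \<mu> - inverse \<mu>" using s0 by (simp add: m_def)
  then have "s\<^sup>2 * (1 - m\<^sup>2) = (\<mu> + inverse \<mu>)\<^sup>2 - (\<mu> - inverse \<mu>)\<^sup>2"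
    unfolding s_def[symmetric] by (metis (no_types) mult.commute mult.right_neutral power_mult_distrib right_diff_distrib)
  then have s2: "s\<^sup>2 * (1 - m\<^sup>2) = 4" using mu1 by (simp add: power2_eq_square algebra_simps)
  have "\<bar>\<mu> - inverse \<mu>\<bar> < s" unfolding s_def using assms(6) i0 by linarith
  then have m1: "\<bar>m\<bar> < 1" using s0 by (simp add: m_def abs_divide)
  have "s\<^sup>2 - 2 = \<mu>\<^sup>2 + (inverse \<mu>)\<^sup>2" using mu1 by (simp add: s_def power2_eq_square algebra_simps)
  then have \<beta>: "2 * \<beta> = s - sqrt (s\<^sup>2 - 2)" using assms by (simp add: s_def)
  obtain x y z :: real where D': "D = pauli 1 x y z" and ball: "x\<^sup>2 + y\<^sup>2 + z\<^sup>2 < 1"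
    by (rule strictly_pos_density_pauli[OF D])
  interpret flow: bloch_flow s \<gamma> m x y z
    using s0 s2 m1 assms(9) ball by unfold_locales
  have \<rho>: "\<rho> = pauli 1 0 0 m" unfolding assms(8) m_def s_def by (rule cliff_rho_pauli[OF assms(6)])
  have "\<Phi> t (pauli a x y z) = pauli (a + complex_of_real (m * (1 - exp (- s * t))) * z)
      (complex_of_real (exp (- (s / 2 - \<gamma>) * t)) * x) (complex_of_real (exp (- (s / 2 + \<gamma>) * t)) * y)
      (complex_of_real (exp (- s * t)) * z)" for a x y z
    unfolding assms(7)
    by (rule exp_semigroup_pauli) (simp only: generator_pauli[OF assms(6)] m_def s_def)
  from tr_adjoint_pauli[OF this]
  have "tr_adjoint (\<Phi> t) D = pauli 1 (flow.x t) (flow.y t) (flow.z t)"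
    by (simp add: D' pauli_eq_iff flow.x_def flow.y_def flow.z_def algebra_simps)
  moreover have "(flow.x t)\<^sup>2 + (flow.y t)\<^sup>2 + (flow.z t)\<^sup>2 < 1"
    using flow.ball_invariant[OF t] by (simp add: flow.sqr_def)
  ultimately have "rel_entropy (tr_adjoint (\<Phi> t) D) \<rho> = bloch_entropy m (flow.x t) (flow.y t) (flow.z t)"
    unfolding \<rho> using rel_entropy_pauli m1 by simp
  also have "\<dots> \<le> exp (- (s - sqrt (s\<^sup>2 - 2)) * t) * bloch_entropy m x y z"
    by (rule flow.entropy_decay[OF t])
  also have "bloch_entropy m x y z = rel_entropy D \<rho>"
    unfolding \<rho> D' using rel_entropy_pauli ball m1 by simp
  finally show "rel_entropy (tr_adjoint (\<Phi> t) D) \<rho> \<le> exp (- 2 * \<beta> * t) * rel_entropy D \<rho>"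
    unfolding \<beta>[symmetric] by simp
qed

end
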